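(* Suppose the only information given to arriving customers is the total number of customers in the network. Let $$K=\min\{k\in\mathbb{N}:\ P(k)<0\},$$ with $K=\infty$ if this set is empty. Then the $K$-strategy (a customer enters if and only if she finds fewer than $K$ customers in the system) is an equilibrium strategy, i.e. it is a best response against itself. Moreover, the $K$-strategy is a dominant strategy in the class of threshold strategies, i.e. it is a best response against the $K'$-strategy for every threshold $K'$.
   Context: $\mathbb{N}=\{0,1,2,\dots\}$. Consider a tandem network of two single-server queues with infinite buffers and first-in-first-out discipline. All service times are independent; those at node $l\in\{1,2\}$ are exponentially distributed with rate $\mu_l>0$. Customers arrive according to a Poisson process of rate $\lambda>0$; on arrival each is told only the total number $k$ of customers in the network and decides to join (at the end of queue 1) or balk. A customer completing service at node 1 moves to node 2, and a customer completing service at node 2 leaves the network. The network starts empty. For $n\ge 1$, $m\ge 0$, let a tagged customer join when the network is in state $(n-1,m)$ ($n-1$ customers at node 1, $m$ at node 2, including those in service), so that she occupies position $n$ in the first queue; $T_l(n,m)$ is the expected time she spends at node $l$ (in particular $T_1(n,m)=n/\mu_1$). The threshold strategy with threshold $K'$ (the $K'$-strategy), $K'\in\mathbb{N}\cup\{\infty\}$, is: join if and only if the total number of customers found is less than $K'$. If all other customers use the $K'$-strategy, the total number of customers found on arrival is always at most $K'$, and the stationary law of the state conditional on a total of $k\le K'$ customers is: state $(n,k-n)$ with probability $$p_1(n|k)=\begin{cases}\dfrac{\mu_1^{k-n}\mu_2^{n}(\mu_1-\mu_2)}{\mu_1^{k+1}-\mu_2^{k+1}}, & \mu_1\ne\mu_2,\\[2mm]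 \dfrac{1}{k+1}, & \mu_1=\mu_2,\end{cases}\qquad 0\le n\le k,$$ which does not depend on $K'$ (this formula is used for every $K'$, including $K'=\infty$). Let $T_l(k)=\sum_{n=0}^k p_1(n|k)\,T_l(n+1,k-n)$ be the corresponding conditional expected time at node $l$ of a tagged customer who joins a network containing $k$ customers. A joining customer receives a reward $R$ and pays a cost $C_l\ge 0$ per unit of time spent at node $l$; a balking customer gets $0$. The expected profit from joining after being told $k$ is $$P(k)=R-C_1T_1(k)-C_2T_2(k),$$ irrespective of the threshold used by the others. Standing assumption: $R>C_1/\mu_1+C_2/\mu_2$. A tagged customer told $k$ chooses to join if $P(k)\ge 0$ and to balk if $P(k)<0$. A strategy is a best response against the $K'$-strategy if, when all other customers use the $K'$-strategy, it prescribes this choice at every total $k$ that the tagged customer can find, i.e. at every $k\in\mathbb{N}$ with $k\le K'$; values $k>K'$ are irrelevant. *)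

theory Defs
  imports "HOL-Probability.Probability" "HOL-Library.Extended_Nat"
begin

section \<open>Sojourn times of a tagged customer in the tandem network\<close>

definition exp_law :: "real \<Rightarrow> real measure" where
  "exp_law mu = density lborel (exponential_density mu)"

text \<open>
  An outcome is a pair \<open>(a, b)\<close>: \<open>a i\<close> and \<open>b i\<close> are the service times, from the arrival of the
  tagged customer on, of the \<open>i\<close>-th customer (counted from 0, in first-in-first-out order) to be
  served at node 1 and at node 2. For a customer already in service at that moment this is the
  residual service time, which has the same exponential law by memorylessness. Customers arriving
  after the tagged one stay behind her at both nodes, so their arrival process and their strategy
  play no role in her sojourn times.
\<close>

definition service_law :: "real \<Rightarrow> real \<Rightarrow> ((nat \<Rightarrow> real) \<times> (nat \<Rightarrow> real)) measure" where
  "service_law mu1 mu2 =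
     (\<Pi>\<^sub>M i\<in>(UNIV :: nat set). exp_law mu1) \<Otimes>\<^sub>M (\<Pi>\<^sub>M i\<in>(UNIV :: nat set). exp_law mu2)"

text \<open>
  Time 0 is the arrival of the tagged customer. \<open>exit1 a n\<close> is the time at which the customer in
  position \<open>n\<close> of the first queue leaves node 1 (position 1 being the customer in service).
\<close>

definition exit1 :: "(nat \<Rightarrow> real) \<Rightarrow> nat \<Rightarrow> real" where
  "exit1 a n = (\<Sum>i<n. a i)"

text \<open>
  With \<open>m\<close> customers initially at node 2, the \<open>j\<close>-th customer (\<open>j \<ge> 1\<close>) to be served at node 2 is
  already there if \<open>j \<le> m\<close>, and otherwise arrives there from position \<open>j - m\<close> of the first queue.
  Her service at node 2 begins once she is there and her predecessor has left;
  \<open>exit2 a b m 0 = 0\<close> is a convention, not a customer.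
\<close>

definition arrival2 :: "(nat \<Rightarrow> real) \<Rightarrow> nat \<Rightarrow> nat \<Rightarrow> real" where
  "arrival2 a m j = (if j \<le> m then 0 else exit1 a (j - m))"

fun exit2 :: "(nat \<Rightarrow> real) \<Rightarrow> (nat \<Rightarrow> real) \<Rightarrow> nat \<Rightarrow> nat \<Rightarrow> real" where
  "exit2 a b m 0 = 0"
| "exit2 a b m (Suc j) = max (arrival2 a m (Suc j)) (exit2 a b m j) + b j"

text \<open>
  The tagged customer occupies position \<open>n \<ge> 1\<close> of the first queue, hence is the
  \<open>(m + n)\<close>-th customer to be served at node 2.
\<close>

definition T1 :: "real \<Rightarrow> real \<Rightarrow> nat \<Rightarrow> nat \<Rightarrow> real" where
  "T1 mu1 mu2 n m = (LINT (a, b)|service_law mu1 mu2. exit1 a n)"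

definition T2 :: "real \<Rightarrow> real \<Rightarrow> nat \<Rightarrow> nat \<Rightarrow> real" where
  "T2 mu1 mu2 n m =
     (LINT (a, b)|service_law mu1 mu2. exit2 a b m (m + n) - arrival2 a m (m + n))"


section \<open>Averaging over the state given the total number of customers\<close>

definition p1 :: "real \<Rightarrow> real \<Rightarrow> nat \<Rightarrow> nat \<Rightarrow> real" where
  "p1 mu1 mu2 n k =
     (if mu1 \<noteq> mu2
      then mu1 ^ (k - n) * mu2 ^ n * (mu1 - mu2) / (mu1 ^ (k + 1) - mu2 ^ (k + 1))
      else 1 / (real k + 1))"

definition T1_total :: "real \<Rightarrow> real \<Rightarrow> nat \<Rightarrow> real" where
  "T1_total mu1 mu2 k = (\<Sum>n = 0..k. p1 mu1 mu2 n k * T1 mu1 mu2 (n + 1) (k - n))"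

definition T2_total :: "real \<Rightarrow> real \<Rightarrow> nat \<Rightarrow> real" where
  "T2_total mu1 mu2 k = (\<Sum>n = 0..k. p1 mu1 mu2 n k * T2 mu1 mu2 (n + 1) (k - n))"

definition profit :: "real \<Rightarrow> real \<Rightarrow> real \<Rightarrow> real \<Rightarrow> real \<Rightarrow> nat \<Rightarrow> real" where
  "profit mu1 mu2 R C1 C2 k = R - C1 * T1_total mu1 mu2 k - C2 * T2_total mu1 mu2 k"


section \<open>Strategies\<close>

text \<open>A strategy maps the announced total to \<open>True\<close> (join) or \<open>False\<close> (balk).\<close>

type_synonym strategy = "nat \<Rightarrow> bool"

definition threshold_strategy :: "enat \<Rightarrow> strategy" where
  "threshold_strategy K = (\<lambda>k. enat k < K)"

text \<open>
  In the following definitions \<open>P\<close> is the expected profit from joining as a function of the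
  announced total; it does not depend on the threshold \<open>K'\<close> used by the other customers, which
  only restricts the totals that can be found.
\<close>

definition best_response :: "(nat \<Rightarrow> real) \<Rightarrow> strategy \<Rightarrow> enat \<Rightarrow> bool" where
  "best_response P s K' \<longleftrightarrow> (\<forall>k. enat k \<le> K' \<longrightarrow> (s k \<longleftrightarrow> 0 \<le> P k))"

definition equilibrium_threshold :: "(nat \<Rightarrow> real) \<Rightarrow> enat \<Rightarrow> bool" where
  "equilibrium_threshold P K \<longleftrightarrow> best_response P (threshold_strategy K) K"

definition dominant_threshold :: "(nat \<Rightarrow> real) \<Rightarrow> enat \<Rightarrow> bool" where
  "dominant_threshold P K \<longleftrightarrow> (\<forall>K'. best_response P (threshold_strategy K) K')"

definition first_negative :: "(nat \<Rightarrow> real) \<Rightarrow> enat" where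
  "first_negative P = (if \<exists>k. P k < 0 then enat (LEAST k. P k < 0) else \<infinity>)"

end

theory Submission
  imports Defs
begin

text \<open>
  The point is that the expected profit is nonincreasing in the announced total \<open>k\<close>. Conditioning
  on the first service completion, memorylessness turns the expected time at node 2 into the
  solution of a linear recursion in the state \<open>(n, m)\<close>. The conditional law of the state given
  \<open>k\<close> is the stationary law of the closed cyclic network of the two queues with \<open>k\<close> customers. By
  the arrival theorem, a further customer circulating in that network sees this law whenever she
  arrives at node 1, and also when she next arrives at node 2; customers fed back behind her do not
  affect her, by first-in-first-out. Hence her expected time at node 2 is the mean of \<open>k - n + 1\<close>,
  divided by the service rate, under the weights \<open>\<mu>\<^sub>1 ^ (k - n) * \<mu>\<^sub>2 ^ n\<close>, and both expected times
  are means of truncated geometric laws, which increase with \<open>k\<close>.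
\<close>

section \<open>The recursion for the mean time at node 2\<close>

text \<open>State \<open>(0, m)\<close> means that the tagged customer has just moved to node 2; \<open>m\<close> then counts her.\<close>

fun sojourn2_mean :: "real \<Rightarrow> real \<Rightarrow> nat \<Rightarrow> nat \<Rightarrow> real" where
  "sojourn2_mean u v 0 m = real m / v"
| "sojourn2_mean u v (Suc n) 0 = sojourn2_mean u v n 1"
| "sojourn2_mean u v (Suc n) (Suc m) =
     (u * sojourn2_mean u v n (Suc (Suc m)) + v * sojourn2_mean u v (Suc n) m) / (u + v)"

lemma sojourn2_mean_nonneg:
  "u > 0 \<Longrightarrow> v > 0 \<Longrightarrow> 0 \<le> sojourn2_mean u v n m"
  by (induction u v n m rule: sojourn2_mean.induct) auto

text \<open>With node 2 empty, the next event moves the head of queue 1 to node 2. The summand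
  \<open>i = 0\<close> is the tagged customer moving there alone, hence
  \<open>1 / v\<close>.\<close>

lemma sum_sojourn2_mean_0:
  "(\<Sum>i<Suc n. sojourn2_mean u v (Suc i) 0) = 1 / v + (\<Sum>i<n. sojourn2_mean u v (Suc i) 1)"
  by (simp add: sum.lessThan_Suc_shift del: sum.lessThan_Suc)

text \<open>First-step equation summed over the possible positions of the tagged customer. The
  summand \<open>i = 0\<close> is split off: on completing node 1 she becomes the last of
  \<open>m + 2\<close> customers at node 2.\<close>

lemma sum_sojourn2_mean_Suc:
  assumes "u + v \<noteq> 0"
  shows "(u + v) * (\<Sum>i<Suc n. sojourn2_mean u v (Suc i) (Suc m)) =
     u * (real (m + 2) / v + (\<Sum>i<n. sojourn2_mean u v (Suc i) (m + 2)))
     + v * (\<Sum>i<Suc n. sojourn2_mean u v (Suc i) m)"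
proof -
  have "(u + v) * (\<Sum>i<Suc n. sojourn2_mean u v (Suc i) (Suc m)) =
      (\<Sum>i<Suc n. u * sojourn2_mean u v i (m + 2) + v * sojourn2_mean u v (Suc i) m)"
    unfolding sum_distrib_left using assms by (intro sum.cong) auto
  also have "\<dots> = u * (\<Sum>i<Suc n. sojourn2_mean u v i (m + 2))
      + v * (\<Sum>i<Suc n. sojourn2_mean u v (Suc i) m)"
    by (simp add: sum.distrib sum_distrib_left del: sum.lessThan_Suc)
  also have "(\<Sum>i<Suc n. sojourn2_mean u v i (m + 2)) =
      real (m + 2) / v + (\<Sum>i<n. sojourn2_mean u v (Suc i) (m + 2))"
    by (simp add: sum.lessThan_Suc_shift del: sum.lessThan_Suc)
  finally show ?thesis .
qed

text \<open>
  Balance equation of the closed network with \<open>k + 1\<close> customers, one of them tagged and, by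
  exchangeability, equally likely to hold each position: \<open>G n m\<close> below sums over her possible
  positions when \<open>n\<close> customers are at node 1. Global balance appears as the telescoping of \<open>c\<close>.
\<close>

lemma sojourn2_mean_balance:
  fixes u v :: real and k :: nat
  assumes "u > 0" "v > 0"
  shows "(\<Sum>n=0..k. u ^ (k - n) * v ^ n * sojourn2_mean u v (Suc n) (k - n)) =
         (\<Sum>n=0..k. u ^ (k - n) * v ^ n * (real (k - n + 1) / v))"
proof -
  define G where "G n m = (\<Sum>i<n. sojourn2_mean u v (Suc i) m)" for n m
  define w where "w n = u ^ (k - n) * v ^ n" for n
  define d where "d n = w n * (sojourn2_mean u v (Suc n) (k - n) - real (k - n + 1) / v)" for n
  define c where "c n = u * w n * (G n (k - n + 1) - G n (k - n))" for n
  have g: "sojourn2_mean u v (Suc n) m = G (Suc n) m - G n m" for n m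
    by (simp add: G_def)
  have step: "u * d n = c n - c (Suc n)" if "n < k" for n
  proof -
    from that obtain m where m: "k - n = Suc m" by (metis Suc_diff_Suc)
    then have m': "k - Suc n = m" by simp
    \<comment> \<open>Cut equation of the closed network: the flow from \<open>n\<close> to
      \<open>Suc n\<close> customers at node 1 equals the flow back.\<close>
    have w: "v * w n = u * w (Suc n)"
      by (simp add: w_def m m')
    have "(u + v) * G (Suc n) (Suc m) =
        u * (real (m + 2) / v + G n (m + 2)) + v * G (Suc n) m"
      unfolding G_def using assms by (intro sum_sojourn2_mean_Suc) auto
    then have *: "u * G (Suc n) (Suc m) - u * (real (m + 2) / v) =
        u * G n (m + 2) + v * G (Suc n) m - v * G (Suc n) (Suc m)"
      by (simp only: algebra_simps)
    have "u * d n = w n * ((u * G (Suc n) (Suc m) - u * (real (m + 2) / v)) - u * G n (Suc m))"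
      unfolding d_def g m by (simp only: algebra_simps) simp
    also have "\<dots> = w n * (u * G n (m + 2) - u * G n (Suc m))
        - (v * w n) * (G (Suc n) (Suc m) - G (Suc n) m)"
      unfolding * by (simp only: algebra_simps)
    also have "\<dots> = c n - c (Suc n)"
      unfolding w c_def m m' by (simp only: algebra_simps) simp
    finally show ?thesis .
  qed
  \<comment> \<open>At \<open>n = k\<close> node 2 is empty and the boundary equation replaces the
    generic one. The result cancels the \<open>- c k\<close> left by telescoping, and
    \<open>c 0 = 0\<close> because \<open>G 0\<close> is an empty sum.\<close>
  have last: "u * d k = c k"
    using sum_sojourn2_mean_0[of u v k] unfolding d_def g c_def by (simp add: G_def algebra_simps)
  have "u * (\<Sum>n=0..k. d n) = (\<Sum>n<k. u * d n) + u * d k"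
    by (simp add: sum_distrib_left atLeast0AtMost lessThan_Suc_atMost[symmetric] distrib_left)
  also have "(\<Sum>n<k. u * d n) = (\<Sum>n<k. c n - c (Suc n))"
    using step by simp
  also have "\<dots> = c 0 - c k"
    by (rule sum_lessThan_telescope')
  finally have "(\<Sum>n=0..k. d n) = 0"
    using assms by (simp add: last c_def G_def)
  then show ?thesis
    by (simp add: d_def w_def right_diff_distrib sum_subtractf)
qed

section \<open>Means of truncated geometric laws\<close>

text \<open>One formula for both cases: the geometric factorization of a difference of powers
  cancels \<open>mu1 - mu2\<close>, and for equal rates all weights coincide.\<close>

lemma p1_eq_weight:
  assumes "mu1 > 0" "mu2 > 0" "n \<le> k"
  shows "p1 mu1 mu2 n k = mu1 ^ (k - n) * mu2 ^ n / (\<Sum>i=0..k. mu1 ^ (k - i) * mu2 ^ i)"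
proof (cases "mu1 = mu2")
  case True
  have "mu2 ^ (k - i) * mu2 ^ i = mu2 ^ k" if "i \<le> k" for i
    using that by (simp flip: power_add)
  with assms True show ?thesis
    by (simp add: p1_def)
next
  case False
  have "mu2 ^ Suc k - mu1 ^ Suc k = (mu2 - mu1) * (\<Sum>i=0..k. mu1 ^ (k - i) * mu2 ^ i)"
    unfolding diff_power_eq_sum
    by (simp only: lessThan_Suc_atMost atLeast0AtMost) (simp add: mult.commute)
  then have "mu1 ^ (k + 1) - mu2 ^ (k + 1) =
      (mu1 - mu2) * (\<Sum>i=0..k. mu1 ^ (k - i) * mu2 ^ i)"
    by (simp add: algebra_simps)
  with False show ?thesis
    by (simp add: p1_def)
qed

text \<open>Mean number of customers at node 1 given a total of \<open>k\<close>. With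
  \<open>u\<close> and \<open>v\<close> exchanged it is the mean number at node 2.\<close>

definition mean_position :: "real \<Rightarrow> real \<Rightarrow> nat \<Rightarrow> real" where
  "mean_position u v k =
     (\<Sum>n=0..k. u ^ (k - n) * v ^ n * real n) / (\<Sum>n=0..k. u ^ (k - n) * v ^ n)"

text \<open>Passing from \<open>k\<close> to \<open>Suc k\<close> scales the old weights by
  \<open>u\<close>, which leaves the mean unchanged, and adds an atom at \<open>Suc k\<close>, above
  all old values; so the mean cannot drop.\<close>

lemma mean_position_mono:
  assumes "u > 0" "v > 0"
  shows "incseq (mean_position u v)"
proof (rule incseq_SucI)
  fix k
  define A where "A k = (\<Sum>n=0..k. u ^ (k - n) * v ^ n * real n)" for k
  define W where "W k = (\<Sum>n=0..k. u ^ (k - n) * v ^ n)" for k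
  have pos: "W k > 0" for k
    unfolding W_def using assms by (intro sum_pos) auto
  have "A k \<le> (\<Sum>n=0..k. u ^ (k - n) * v ^ n * real k)"
    unfolding A_def using assms by (intro sum_mono mult_left_mono) auto
  also have "\<dots> = real k * W k"
    by (simp add: W_def sum_distrib_left mult.commute)
  finally have "A k \<le> real k * W k" .
  moreover have "real k * W k \<le> real (Suc k) * W k"
    using pos[of k] by (intro mult_right_mono) auto
  ultimately have AW: "A k \<le> real (Suc k) * W k" by linarith
  have A: "A (Suc k) = u * A k + v ^ Suc k * real (Suc k)"
    unfolding A_def by (simp add: sum_distrib_left Suc_diff_le mult.assoc)
  have W: "W (Suc k) = u * W k + v ^ Suc k"
    unfolding W_def by (simp add: sum_distrib_left Suc_diff_le mult.assoc)
  have "v ^ Suc k * A k \<le> v ^ Suc k * (real (Suc k) * W k)"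
    using AW assms by (intro mult_left_mono) auto
  \<comment> \<open>After cross-multiplication the common term \<open>u * A k * W k\<close>
    cancels.\<close>
  then have "A k * W (Suc k) \<le> A (Suc k) * W k"
    unfolding A W by (simp only: algebra_simps)
  then have "A k / W k \<le> A (Suc k) / W (Suc k)"
    using pos by (simp add: field_simps)
  then show "mean_position u v k \<le> mean_position u v (Suc k)"
    by (simp only: mean_position_def A_def W_def)
qed

lemma weighted_mean_Suc:
  assumes "u > 0" "v > 0"
  shows "(\<Sum>n=0..k. u ^ (k - n) * v ^ n * (real n + 1)) / (\<Sum>n=0..k. u ^ (k - n) * v ^ n) =
    mean_position u v k + 1"
proof -
  have "(\<Sum>n=0..k. u ^ (k - n) * v ^ n) > 0"
    using assms by (intro sum_pos) auto
  then show ?thesis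
    by (simp add: mean_position_def distrib_left sum.distrib add_divide_distrib)
qed

lemma weighted_mean_reflect:
  assumes "u > 0" "v > 0"
  shows "(\<Sum>n=0..k. u ^ (k - n) * v ^ n * (real (k - n) + 1)) / (\<Sum>n=0..k. u ^ (k - n) * v ^ n) =
    mean_position v u k + 1"
proof -
  have "(\<Sum>n=0..k. u ^ (k - n) * v ^ n * f (k - n)) = (\<Sum>n=0..k. v ^ (k - n) * u ^ n * f n)"
    for f :: "nat \<Rightarrow> real"
    by (rule sum.reindex_bij_witness[of _ "\<lambda>n. k - n" "\<lambda>n. k - n"]) (auto simp: mult.commute)
  from this[of "\<lambda>n. real n + 1"] this[of "\<lambda>_. 1"] show ?thesis
    using weighted_mean_Suc[of v u k] assms by simp
qed

section \<open>Best responses when the profit is nonincreasing\<close>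

lemma best_response_first_negative:
  assumes "antimono P" and "K = first_negative P"
  shows "best_response P (threshold_strategy K) K'"
proof -
  \<comment> \<open>Monotonicity keeps \<open>P\<close> negative from its first negative value on.
    The equivalence is proved at every total \<open>k\<close>, which serves all \<open>K'\<close> at
    once.\<close>
  have "enat k < K \<longleftrightarrow> 0 \<le> P k" for k
  proof (cases "\<exists>k. P k < 0")
    case True
    define k0 where "k0 = (LEAST k. P k < 0)"
    have "P k0 < 0"
      unfolding k0_def using True by (rule LeastI_ex)
    moreover have "0 \<le> P k" if "k < k0" for k
      using not_less_Least[of k "\<lambda>k. P k < 0"] that by (simp add: k0_def not_less)
    ultimately have "k < k0 \<longleftrightarrow> 0 \<le> P k"
      using antimonoD[OF assms(1), of k0 k] by (cases "k < k0") (auto simp: not_less)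
    then show ?thesis
      using True by (simp add: assms(2) first_negative_def k0_def)
  next
    case False
    then have "K = \<infinity>"
      by (simp only: assms(2) first_negative_def if_False simp_thms)
    then show ?thesis
      using False by (simp add: not_less)
  qed
  then show ?thesis
    by (simp add: best_response_def threshold_strategy_def)
qed

section \<open>Pathwise shift at the first service completion\<close>

text \<open>The integrand of \<open>T2\<close>, extended to \<open>n = 0\<close>, where the tagged
  customer is the last of the \<open>m\<close> customers at node 2.\<close>

definition sojourn2 :: "(nat \<Rightarrow> real) \<Rightarrow> (nat \<Rightarrow> real) \<Rightarrow> nat \<Rightarrow> nat \<Rightarrow> real" where
  "sojourn2 a b n m = exit2 a b m (m + n) - arrival2 a m (m + n)"

lemma exit1_case_nat: "exit1 (case_nat x a) (Suc n) = x + exit1 a n"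
  by (simp add: exit1_def sum.lessThan_Suc_shift del: sum.lessThan_Suc)

lemma exit2_nonneg:
  assumes "\<And>i. 0 \<le> b i"
  shows "0 \<le> exit2 a b m j"
proof (induction j)
  case (Suc j)
  then show ?case
    using assms[of j] by (simp add: max_def)
qed simp

lemma sojourn2_nonneg:
  assumes "\<And>i. 0 \<le> b i"
  shows "0 \<le> sojourn2 a b n m"
proof (cases "m + n")
  case 0
  then show ?thesis by (simp add: sojourn2_def arrival2_def)
next
  case (Suc j)
  then show ?thesis using assms[of j] by (simp add: sojourn2_def max_def)
qed

lemma exit2_already_present:
  assumes "\<And>i. 0 \<le> b i" and "j \<le> m"
  shows "exit2 a b m j = (\<Sum>i<j. b i)"
  using assms(2)
proof (induction j)
  case (Suc j)
  then show ?case
    using exit2_nonneg[of b, OF assms(1), of a m j] by (simp add: arrival2_def max_def)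
qed simp

text \<open>Node 2 idles until time \<open>x\<close>; with the clock restarted then, one customer is
  present there. The claim begins at \<open>Suc j\<close> because the convention for index 0 does
  not shift with the clock.\<close>

lemma exit2_shift_idle:
  assumes "0 \<le> x"
  shows "exit2 (case_nat x a) b 0 (Suc j) = x + exit2 a b 1 (Suc j)"
proof (induction j)
  case 0
  then show ?case using assms by (simp add: arrival2_def exit1_case_nat) (simp add: exit1_def)
next
  case (Suc j)
  have "arrival2 (case_nat x a) 0 (Suc (Suc j)) = x + arrival2 a 1 (Suc (Suc j))"
    by (simp add: arrival2_def exit1_case_nat)
  then show ?case
    unfolding exit2.simps(2)[of _ _ _ "Suc j"] Suc by (simp del: exit2.simps add: max_add_distrib_right)
qed

text \<open>Node 1 finishes first. From time \<open>x\<close> on, node 2 holds one more customer and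
  its current service has \<open>y - x\<close> left; nobody has left node 2, so the numbering is
  kept.\<close>

lemma exit2_shift_node1:
  assumes "\<And>i. 0 \<le> b i" and "0 \<le> x" and "x \<le> y"
  shows "exit2 (case_nat x a) (case_nat y b) (Suc m) (Suc j) =
    x + exit2 a (case_nat (y - x) b) (Suc (Suc m)) (Suc j)"
proof (induction j)
  case 0
  then show ?case by (simp add: arrival2_def)
next
  case (Suc j)
  define E where "E = exit2 a (case_nat (y - x) b) (Suc (Suc m)) (Suc j)"
  have "0 \<le> E"
    unfolding E_def using assms by (intro exit2_nonneg) (auto split: nat.split)
  have "max (arrival2 (case_nat x a) (Suc m) (Suc (Suc j))) (x + E) =
      x + max (arrival2 a (Suc (Suc m)) (Suc (Suc j))) E"
  \<comment> \<open>Customers initially at node 2 have \<open>j < m\<close>, the one who moves at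
    time \<open>x\<close> has \<open>j = m\<close>, and later arrivals have
    \<open>j > m\<close>.\<close>
  proof (cases "j < m")
    case True
    then show ?thesis using \<open>0 \<le> E\<close> assms(2) by (simp add: arrival2_def)
  next
    case False
    then have "Suc j - m = Suc (j - m)" by simp
    then show ?thesis
      using False \<open>0 \<le> E\<close> assms(2)
      by (cases "j = m") (auto simp: arrival2_def exit1_case_nat max_add_distrib_right exit1_def[of _ 0])
  qed
  then show ?case
    unfolding exit2.simps(2)[of _ _ _ "Suc j"] Suc by (simp add: E_def del: exit2.simps)
qed

text \<open>Node 2 finishes first. Its head leaves at time \<open>y\<close>, so the numbering drops
  by one, and node 1 has \<open>x - y\<close> left. At \<open>j = 0\<close> the convention
  \<open>exit2 a b m 0 = 0\<close> gives exactly this departure.\<close>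

lemma exit2_shift_node2:
  assumes "\<And>i. 0 \<le> b i" and "0 \<le> y" and "y \<le> x"
  shows "exit2 (case_nat x a) (case_nat y b) (Suc m) (Suc j) =
    y + exit2 (case_nat (x - y) a) b m j"
proof (induction j)
  case 0
  then show ?case by (simp add: arrival2_def)
next
  case (Suc j)
  define E where "E = exit2 (case_nat (x - y) a) b m j"
  have "0 \<le> E"
    unfolding E_def using assms by (intro exit2_nonneg) (auto split: nat.split)
  have "max (arrival2 (case_nat x a) (Suc m) (Suc (Suc j))) (y + E) =
      y + max (arrival2 (case_nat (x - y) a) m (Suc j)) E"
  proof (cases "j < m")
    case True
    then show ?thesis using \<open>0 \<le> E\<close> assms(2) by (simp add: arrival2_def)
  next
    case False
    then have "Suc j - m = Suc (j - m)" by simp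
    then show ?thesis
      using False by (simp add: arrival2_def exit1_case_nat max_add_distrib_right)
  qed
  then show ?case
    unfolding exit2.simps(2)[of _ _ _ "Suc j"] Suc by (simp add: E_def)
qed

text \<open>Arrival and exit times shift equally, so their difference is unaffected. For
  \<open>n = 0\<close> the tagged customer herself moves, and her arrival becomes time 0 of the new
  clock.\<close>

lemma sojourn2_shift_idle:
  assumes "0 \<le> x"
  shows "sojourn2 (case_nat x a) b (Suc n) 0 = sojourn2 a b n 1"
  using exit2_shift_idle[OF assms, of a b n]
  by (cases n) (simp_all add: sojourn2_def arrival2_def exit1_case_nat exit1_def[of _ 0] del: exit2.simps)

lemma sojourn2_shift_node1:
  assumes "\<And>i. 0 \<le> b i" and "0 \<le> x" and "x \<le> y"
  shows "sojourn2 (case_nat x a) (case_nat y b) (Suc n) (Suc m) =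
    sojourn2 a (case_nat (y - x) b) n (Suc (Suc m))"
  using exit2_shift_node1[of b x y a m "m + Suc n", OF assms]
  by (cases n) (simp_all add: sojourn2_def arrival2_def exit1_case_nat exit1_def[of _ 0] del: exit2.simps)

lemma sojourn2_shift_node2:
  assumes "\<And>i. 0 \<le> b i" and "0 \<le> y" and "y \<le> x"
  shows "sojourn2 (case_nat x a) (case_nat y b) (Suc n) (Suc m) =
    sojourn2 (case_nat (x - y) a) b (Suc n) m"
  using exit2_shift_node2[of b y x a m "m + Suc n", OF assms]
  by (simp add: sojourn2_def arrival2_def exit1_case_nat del: exit2.simps)

section \<open>Exponential laws\<close>

lemma sets_exp_law [simp, measurable_cong]: "sets (exp_law mu) = sets borel"
  by (simp add: exp_law_def)

lemma space_exp_law [simp]: "space (exp_law mu) = UNIV"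
  by (simp add: exp_law_def)

lemma prob_space_exp_law: "mu > 0 \<Longrightarrow> prob_space (exp_law mu)"
  unfolding exp_law_def by (rule prob_space_exponential_density)

lemma AE_exp_law_nonneg: "AE x in exp_law mu. 0 \<le> x"
  unfolding exp_law_def by (subst AE_density) (auto simp: exponential_density_def)

lemma nn_integral_exp_law:
  assumes [measurable]: "f \<in> borel_measurable borel"
  shows "(\<integral>\<^sup>+x. f x \<partial>exp_law mu) = (\<integral>\<^sup>+x. ennreal (exponential_density mu x) * f x \<partial>lborel)"
  unfolding exp_law_def by (subst nn_integral_density) auto

lemma nn_integral_exp_law_id:
  assumes "mu > 0"
  shows "(\<integral>\<^sup>+x. ennreal x \<partial>exp_law mu) = ennreal (1 / mu)"
proof -
  have "(\<integral>\<^sup>+x. ennreal x \<partial>exp_law mu) =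
      (\<integral>\<^sup>+x. ennreal (exponential_density mu x * x ^ 1) \<partial>lborel)"
    by (subst nn_integral_exp_law)
       (auto intro!: nn_integral_cong simp: exponential_density_def ennreal_mult' assms less_imp_le
         simp flip: ennreal_mult')
  \<comment> \<open>The exponential law is the Erlang law with parameter 0; the power
    \<open>x ^ 1\<close> exhibits its first moment.\<close>
  also have "\<dots> = ennreal (1 / mu)"
    using nn_integral_erlang_ith_moment[OF assms, of 0 1] assms by simp
  finally show ?thesis .
qed

text \<open>The predicate \<open>Q\<close> leaves the value at the tie \<open>y = x\<close> open, so that ties can be
  broken either way.\<close>

lemma exp_law_memoryless:
  assumes mu: "mu > 0" and x: "0 \<le> x"
    and [measurable]: "f \<in> borel_measurable borel"
    and Q: "\<And>y. x < y \<Longrightarrow> Q y" "\<And>y. y < x \<Longrightarrow> \<not> Q y"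
    and [measurable]: "Measurable.pred borel Q"
  shows "(\<integral>\<^sup>+y. (if Q y then f (y - x) else 0) \<partial>exp_law mu) =
    ennreal (exp (- mu * x)) * (\<integral>\<^sup>+z. f z \<partial>exp_law mu)"
proof -
  have "(\<integral>\<^sup>+y. (if Q y then f (y - x) else 0) \<partial>exp_law mu) =
      (\<integral>\<^sup>+y. ennreal (exponential_density mu y) * (if Q y then f (y - x) else 0) \<partial>lborel)"
    by (rule nn_integral_exp_law) measurable
  also have "\<dots> = (\<integral>\<^sup>+z. ennreal (exponential_density mu (x + z)) * (if Q (x + z) then f z else 0) \<partial>lborel)"
    by (subst nn_integral_real_affine[where c=1 and t=x]) (auto intro!: nn_integral_cong)
  also have "\<dots> = (\<integral>\<^sup>+z. ennreal (exp (- mu * x)) * (ennreal (exponential_density mu z) * f z) \<partial>lborel)"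
  proof (rule nn_integral_cong_AE)
    \<comment> \<open>The tie is now \<open>z = 0\<close>, a null set. For \<open>z < 0\<close> the
      left side vanishes by \<open>Q\<close> and the right side because the density is zero.\<close>
    show "AE z in lborel. ennreal (exponential_density mu (x + z)) * (if Q (x + z) then f z else 0) =
        ennreal (exp (- mu * x)) * (ennreal (exponential_density mu z) * f z)"
      using AE_lborel_singleton[of 0]
    proof eventually_elim
      case (elim z)
      show ?case
      proof (cases "z < 0")
        case True
        then show ?thesis using Q(2)[of "x + z"] by (simp add: exponential_density_def)
      next
        case False
        with elim have "z > 0" by simp
        then have "exponential_density mu (x + z) = exp (- mu * x) * exponential_density mu z"
          using x by (simp add: exponential_density_def algebra_simps flip: exp_add)
        then show ?thesis
          using Q(1)[of "x + z"] \<open>z > 0\<close> mu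
          by (simp add: ennreal_mult exponential_density_nonneg mult.assoc)
      qed
    qed
  qed
  also have "\<dots> = ennreal (exp (- mu * x)) * (\<integral>\<^sup>+z. f z \<partial>exp_law mu)"
    by (subst nn_integral_cmult) (auto simp: nn_integral_exp_law)
  finally show ?thesis .
qed

text \<open>The probability that a clock of rate \<open>u\<close> rings before an independent one of
  rate \<open>v\<close>. The product of \<open>exp (- v * x)\<close> with the density is a multiple
  of the density of rate \<open>u + v\<close>.\<close>

lemma exp_law_laplace:
  assumes "u > 0" "v > 0"
  shows "(\<integral>\<^sup>+x. ennreal (exp (- v * x)) \<partial>exp_law u) = ennreal (u / (u + v))"
proof -
  have uv: "u + v > 0" using assms by simp
  have "(\<integral>\<^sup>+x. ennreal (exp (- v * x)) \<partial>exp_law u) =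
      (\<integral>\<^sup>+x. ennreal (u / (u + v)) * ennreal (exponential_density (u + v) x) \<partial>lborel)"
    using assms uv
    by (subst nn_integral_exp_law)
       (auto intro!: nn_integral_cong simp: exponential_density_def field_simps
         simp flip: ennreal_mult' exp_add)
  also have "\<dots> = ennreal (u / (u + v))"
    using nn_integral_erlang_ith_moment[OF uv, of 0 0] by (subst nn_integral_cmult) auto
  finally show ?thesis .
qed

text \<open>The two terms correspond to the winner of the race; by memorylessness the residual time
  of the loser is again exponential.\<close>

lemma exp_law_race:
  assumes u: "u > 0" and v: "v > 0"
    and [measurable]: "f \<in> borel_measurable borel" "g \<in> borel_measurable borel"
  shows "(\<integral>\<^sup>+x. \<integral>\<^sup>+y. (if x \<le> y then f (y - x) else g (x - y)) \<partial>exp_law v \<partial>exp_law u) =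
    ennreal (u / (u + v)) * (\<integral>\<^sup>+z. f z \<partial>exp_law v) + ennreal (v / (u + v)) * (\<integral>\<^sup>+z. g z \<partial>exp_law u)"
proof -
  interpret U: prob_space "exp_law u" by (rule prob_space_exp_law) fact
  interpret V: prob_space "exp_law v" by (rule prob_space_exp_law) fact
  interpret UV: pair_sigma_finite "exp_law u" "exp_law v" ..
  have f: "(\<integral>\<^sup>+y. (if x \<le> y then f (y - x) else 0) \<partial>exp_law v) =
      ennreal (exp (- v * x)) * (\<integral>\<^sup>+z. f z \<partial>exp_law v)" if "0 \<le> x" for x
    by (rule exp_law_memoryless[OF v that]) auto
  have g: "(\<integral>\<^sup>+x. (if y < x then g (x - y) else 0) \<partial>exp_law u) =
      ennreal (exp (- u * y)) * (\<integral>\<^sup>+z. g z \<partial>exp_law u)" if "0 \<le> y" for y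
    by (rule exp_law_memoryless[OF u that]) auto
  have "(\<integral>\<^sup>+x. \<integral>\<^sup>+y. (if x \<le> y then f (y - x) else g (x - y)) \<partial>exp_law v \<partial>exp_law u) =
      (\<integral>\<^sup>+x. (\<integral>\<^sup>+y. (if x \<le> y then f (y - x) else 0) \<partial>exp_law v)
        + (\<integral>\<^sup>+y. (if y < x then g (x - y) else 0) \<partial>exp_law v) \<partial>exp_law u)"
    by (intro nn_integral_cong, subst nn_integral_add[symmetric]) (auto intro!: nn_integral_cong)
  also have "\<dots> = (\<integral>\<^sup>+x. \<integral>\<^sup>+y. (if x \<le> y then f (y - x) else 0) \<partial>exp_law v \<partial>exp_law u)
      + (\<integral>\<^sup>+x. \<integral>\<^sup>+y. (if y < x then g (x - y) else 0) \<partial>exp_law v \<partial>exp_law u)"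
    by (rule nn_integral_add) measurable
  \<comment> \<open>Memorylessness applies to the inner variable, which must be the loser; hence the
    exchange of integrals when \<open>y\<close> wins.\<close>
  also have "(\<integral>\<^sup>+x. \<integral>\<^sup>+y. (if y < x then g (x - y) else 0) \<partial>exp_law v \<partial>exp_law u) =
      (\<integral>\<^sup>+y. \<integral>\<^sup>+x. (if y < x then g (x - y) else 0) \<partial>exp_law u \<partial>exp_law v)"
    by (rule UV.Fubini'[symmetric]) measurable
  also have "\<dots> = (\<integral>\<^sup>+y. ennreal (exp (- u * y)) * (\<integral>\<^sup>+z. g z \<partial>exp_law u) \<partial>exp_law v)"
    using AE_exp_law_nonneg[of v]
    by (intro nn_integral_cong_AE) (auto elim!: eventually_mono simp: g)
  also have "\<dots> = ennreal (v / (u + v)) * (\<integral>\<^sup>+z. g z \<partial>exp_law u)"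
    using exp_law_laplace[OF v u] by (subst nn_integral_multc) (auto simp: add.commute)
  also have "(\<integral>\<^sup>+x. \<integral>\<^sup>+y. (if x \<le> y then f (y - x) else 0) \<partial>exp_law v \<partial>exp_law u) =
      (\<integral>\<^sup>+x. ennreal (exp (- v * x)) * (\<integral>\<^sup>+z. f z \<partial>exp_law v) \<partial>exp_law u)"
    using AE_exp_law_nonneg[of u]
    by (intro nn_integral_cong_AE) (auto elim!: eventually_mono simp: f)
  also have "\<dots> = ennreal (u / (u + v)) * (\<integral>\<^sup>+z. f z \<partial>exp_law v)"
    using exp_law_laplace[OF u v] by (subst nn_integral_multc) auto
  finally show ?thesis .
qed

section \<open>Independent service times\<close>

lemma sets_service_law [measurable_cong]:
  "sets (service_law u v) = sets ((\<Pi>\<^sub>M i\<in>UNIV. borel) \<Otimes>\<^sub>M (\<Pi>\<^sub>M i\<in>UNIV. borel))"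
  unfolding service_law_def by (intro sets_pair_measure_cong sets_PiM_cong) auto

text \<open>Prepending an independent draw to an i.i.d. sequence reproduces the law of the
  sequence.\<close>

lemma nn_integral_PiM_case_nat:
  assumes "prob_space M" and [measurable]: "F \<in> borel_measurable (\<Pi>\<^sub>M i\<in>(UNIV::nat set). M)"
  shows "(\<integral>\<^sup>+s. F s \<partial>(\<Pi>\<^sub>M i\<in>UNIV. M)) =
    (\<integral>\<^sup>+x. \<integral>\<^sup>+s. F (case_nat x s) \<partial>(\<Pi>\<^sub>M i\<in>UNIV. M) \<partial>M)"
proof -
  interpret M: prob_space M by fact
  interpret sequence_space M ..
  have "(\<integral>\<^sup>+s. F s \<partial>S) = (\<integral>\<^sup>+s. F s \<partial>distr (M \<Otimes>\<^sub>M S) S (\<lambda>(s, \<omega>). case_nat s \<omega>))"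
    by (simp add: PiM_iter)
  also have "\<dots> = (\<integral>\<^sup>+(x, s). F (case_nat x s) \<partial>(M \<Otimes>\<^sub>M S))"
    by (subst nn_integral_distr) (simp_all add: case_prod_beta')
  also have "\<dots> = (\<integral>\<^sup>+x. \<integral>\<^sup>+s. F (case_nat x s) \<partial>S \<partial>M)"
    by (subst P.nn_integral_fst[symmetric]) auto
  finally show ?thesis .
qed

lemma prob_space_seq_exp_law: "mu > 0 \<Longrightarrow> prob_space (\<Pi>\<^sub>M i\<in>UNIV. exp_law mu)"
  by (intro prob_space_PiM prob_space_exp_law)

text \<open>The integral over \<open>a\<close> is taken innermost, its first coordinate is split
  off, and Fubini moves that coordinate outside.\<close>

lemma nn_integral_service_law_case_nat1:
  assumes u: "u > 0" and v: "v > 0"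
    and F: "(\<lambda>(a, b). F a b) \<in> borel_measurable ((\<Pi>\<^sub>M i\<in>UNIV. borel) \<Otimes>\<^sub>M (\<Pi>\<^sub>M i\<in>UNIV. borel))"
  shows "(\<integral>\<^sup>+(a, b). F a b \<partial>service_law u v) =
    (\<integral>\<^sup>+x. \<integral>\<^sup>+(a, b). F (case_nat x a) b \<partial>service_law u v \<partial>exp_law u)"
proof -
  interpret E: prob_space "exp_law u" by (rule prob_space_exp_law) fact
  interpret A: prob_space "\<Pi>\<^sub>M i\<in>(UNIV::nat set). exp_law u" by (rule prob_space_seq_exp_law) fact
  interpret B: prob_space "\<Pi>\<^sub>M i\<in>(UNIV::nat set). exp_law v" by (rule prob_space_seq_exp_law) fact
  interpret AB: pair_sigma_finite "\<Pi>\<^sub>M i\<in>(UNIV::nat set). exp_law u" "\<Pi>\<^sub>M i\<in>(UNIV::nat set). exp_law v" ..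
  interpret EB: pair_sigma_finite "exp_law u" "\<Pi>\<^sub>M i\<in>(UNIV::nat set). exp_law v" ..
  have [measurable]: "(\<lambda>(a, b). F a b) \<in>
      borel_measurable ((\<Pi>\<^sub>M i\<in>UNIV. exp_law u) \<Otimes>\<^sub>M (\<Pi>\<^sub>M i\<in>UNIV. exp_law v))"
    using F by (subst measurable_cong_sets[OF sets_service_law[unfolded service_law_def] refl])
  have "(\<integral>\<^sup>+(a, b). F a b \<partial>service_law u v) =
      (\<integral>\<^sup>+b. \<integral>\<^sup>+a. F a b \<partial>(\<Pi>\<^sub>M i\<in>UNIV. exp_law u) \<partial>(\<Pi>\<^sub>M i\<in>UNIV. exp_law v))"
    unfolding service_law_def by (subst AB.nn_integral_snd[symmetric]) auto
  also have "\<dots> = (\<integral>\<^sup>+b. \<integral>\<^sup>+x. \<integral>\<^sup>+a. F (case_nat x a) b \<partial>(\<Pi>\<^sub>M i\<in>UNIV. exp_law u) \<partial>exp_law u \<partial>(\<Pi>\<^sub>M i\<in>UNIV. exp_law v))"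
    by (intro nn_integral_cong nn_integral_PiM_case_nat prob_space_exp_law u) measurable
  also have "\<dots> = (\<integral>\<^sup>+x. \<integral>\<^sup>+b. \<integral>\<^sup>+a. F (case_nat x a) b \<partial>(\<Pi>\<^sub>M i\<in>UNIV. exp_law u) \<partial>(\<Pi>\<^sub>M i\<in>UNIV. exp_law v) \<partial>exp_law u)"
    by (rule EB.Fubini') measurable
  also have "\<dots> = (\<integral>\<^sup>+x. \<integral>\<^sup>+(a, b). F (case_nat x a) b \<partial>service_law u v \<partial>exp_law u)"
    unfolding service_law_def by (intro nn_integral_cong, subst AB.nn_integral_snd[symmetric]) auto
  finally show ?thesis .
qed

lemma nn_integral_service_law_case_nat2:
  assumes u: "u > 0" and v: "v > 0"
    and F: "(\<lambda>(a, b). F a b) \<in> borel_measurable ((\<Pi>\<^sub>M i\<in>UNIV. borel) \<Otimes>\<^sub>M (\<Pi>\<^sub>M i\<in>UNIV. borel))"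
  shows "(\<integral>\<^sup>+(a, b). F a b \<partial>service_law u v) =
    (\<integral>\<^sup>+y. \<integral>\<^sup>+(a, b). F a (case_nat y b) \<partial>service_law u v \<partial>exp_law v)"
proof -
  interpret E: prob_space "exp_law v" by (rule prob_space_exp_law) fact
  interpret A: prob_space "\<Pi>\<^sub>M i\<in>(UNIV::nat set). exp_law u" by (rule prob_space_seq_exp_law) fact
  interpret B: prob_space "\<Pi>\<^sub>M i\<in>(UNIV::nat set). exp_law v" by (rule prob_space_seq_exp_law) fact
  interpret EA: pair_sigma_finite "exp_law v" "\<Pi>\<^sub>M i\<in>(UNIV::nat set). exp_law u" ..
  have [measurable]: "(\<lambda>(a, b). F a b) \<in>
      borel_measurable ((\<Pi>\<^sub>M i\<in>UNIV. exp_law u) \<Otimes>\<^sub>M (\<Pi>\<^sub>M i\<in>UNIV. exp_law v))"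
    using F by (subst measurable_cong_sets[OF sets_service_law[unfolded service_law_def] refl])
  have "(\<integral>\<^sup>+(a, b). F a b \<partial>service_law u v) =
      (\<integral>\<^sup>+a. \<integral>\<^sup>+b. F a b \<partial>(\<Pi>\<^sub>M i\<in>UNIV. exp_law v) \<partial>(\<Pi>\<^sub>M i\<in>UNIV. exp_law u))"
    unfolding service_law_def by (subst B.nn_integral_fst[symmetric]) auto
  also have "\<dots> = (\<integral>\<^sup>+a. \<integral>\<^sup>+y. \<integral>\<^sup>+b. F a (case_nat y b) \<partial>(\<Pi>\<^sub>M i\<in>UNIV. exp_law v) \<partial>exp_law v \<partial>(\<Pi>\<^sub>M i\<in>UNIV. exp_law u))"
    by (intro nn_integral_cong nn_integral_PiM_case_nat prob_space_exp_law v) measurable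
  also have "\<dots> = (\<integral>\<^sup>+y. \<integral>\<^sup>+a. \<integral>\<^sup>+b. F a (case_nat y b) \<partial>(\<Pi>\<^sub>M i\<in>UNIV. exp_law v) \<partial>(\<Pi>\<^sub>M i\<in>UNIV. exp_law u) \<partial>exp_law v)"
    by (rule EA.Fubini') measurable
  also have "\<dots> = (\<integral>\<^sup>+y. \<integral>\<^sup>+(a, b). F a (case_nat y b) \<partial>service_law u v \<partial>exp_law v)"
    unfolding service_law_def by (intro nn_integral_cong, subst B.nn_integral_fst[symmetric]) auto
  finally show ?thesis .
qed

lemma prob_space_service_law:
  assumes "u > 0" "v > 0"
  shows "prob_space (service_law u v)"
  unfolding service_law_def using assms
  by (intro prob_space_pair prob_space_seq_exp_law)

lemma AE_service_law_nonneg: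
  assumes u: "u > 0" and v: "v > 0"
  shows "AE (a, b) in service_law u v. (\<forall>i. 0 \<le> a i) \<and> (\<forall>i. 0 \<le> b i)"
proof -
  interpret A: prob_space "\<Pi>\<^sub>M i\<in>(UNIV::nat set). exp_law u" by (rule prob_space_seq_exp_law) fact
  interpret B: prob_space "\<Pi>\<^sub>M i\<in>(UNIV::nat set). exp_law v" by (rule prob_space_seq_exp_law) fact
  interpret AB: pair_sigma_finite "\<Pi>\<^sub>M i\<in>(UNIV::nat set). exp_law u" "\<Pi>\<^sub>M i\<in>(UNIV::nat set). exp_law v" ..
  have *: "AE a in (\<Pi>\<^sub>M i\<in>(UNIV::nat set). exp_law mu). \<forall>i. 0 \<le> a i" if "mu > 0" for mu
    unfolding AE_all_countable
    by (intro allI AE_PiM_component prob_space_exp_law that AE_exp_law_nonneg UNIV_I)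
  show ?thesis
    unfolding service_law_def
  proof (rule AB.AE_pair_measure)
    show "AE a in (\<Pi>\<^sub>M i\<in>(UNIV::nat set). exp_law u). AE b in (\<Pi>\<^sub>M i\<in>(UNIV::nat set). exp_law v).
        case (a, b) of (a, b) \<Rightarrow> (\<forall>i. 0 \<le> a i) \<and> (\<forall>i. 0 \<le> b i)"
      using *[OF u]
    proof eventually_elim
      case (elim a)
      show ?case
        using *[OF v] by eventually_elim (use elim in simp)
    qed
  qed measurable
qed

section \<open>Measurability of the exit times and means of service sums\<close>

lemma measurable_exit1 [measurable]:
  "(\<lambda>a. exit1 a n) \<in> borel_measurable (\<Pi>\<^sub>M i\<in>UNIV. borel)"
  unfolding exit1_def by measurable

lemma measurable_arrival2 [measurable]:
  "(\<lambda>a. arrival2 a m j) \<in> borel_measurable (\<Pi>\<^sub>M i\<in>UNIV. borel)"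
  unfolding arrival2_def by measurable

lemma measurable_exit2 [measurable]:
  "(\<lambda>(a, b). exit2 a b m j) \<in> borel_measurable ((\<Pi>\<^sub>M i\<in>UNIV. borel) \<Otimes>\<^sub>M (\<Pi>\<^sub>M i\<in>UNIV. borel))"
proof (induction j)
  case (Suc j)
  note [measurable] = Suc
  show ?case by simp
qed simp

lemma measurable_sojourn2 [measurable]:
  "(\<lambda>(a, b). sojourn2 a b n m) \<in> borel_measurable ((\<Pi>\<^sub>M i\<in>UNIV. borel) \<Otimes>\<^sub>M (\<Pi>\<^sub>M i\<in>UNIV. borel))"
  unfolding sojourn2_def by measurable

lemma nn_integral_seq_exp_law_component:
  assumes "mu > 0"
  shows "(\<integral>\<^sup>+s. ennreal (s i) \<partial>(\<Pi>\<^sub>M i\<in>UNIV. exp_law mu)) = ennreal (1 / mu)"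
proof -
  have "(\<integral>\<^sup>+x. ennreal x \<partial>exp_law mu) =
      (\<integral>\<^sup>+x. ennreal x \<partial>distr (\<Pi>\<^sub>M i\<in>UNIV. exp_law mu) (exp_law mu) (\<lambda>s. s i))"
    using assms by (subst distr_PiM_component) (auto simp: prob_space_exp_law)
  also have "\<dots> = (\<integral>\<^sup>+s. ennreal (s i) \<partial>(\<Pi>\<^sub>M i\<in>UNIV. exp_law mu))"
    by (subst nn_integral_distr) auto
  finally show ?thesis
    using nn_integral_exp_law_id[OF assms] by simp
qed

lemma nn_integral_service_law_component:
  assumes u: "u > 0" and v: "v > 0"
  shows "(\<integral>\<^sup>+(a, b). ennreal (a i) \<partial>service_law u v) = ennreal (1 / u)"
    and "(\<integral>\<^sup>+(a, b). ennreal (b i) \<partial>service_law u v) = ennreal (1 / v)"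
proof -
  interpret A: prob_space "\<Pi>\<^sub>M i\<in>(UNIV::nat set). exp_law u" by (rule prob_space_seq_exp_law) fact
  interpret B: prob_space "\<Pi>\<^sub>M i\<in>(UNIV::nat set). exp_law v" by (rule prob_space_seq_exp_law) fact
  show "(\<integral>\<^sup>+(a, b). ennreal (a i) \<partial>service_law u v) = ennreal (1 / u)"
    unfolding service_law_def using u
    by (subst B.nn_integral_fst[symmetric])
       (auto simp: B.emeasure_space_1 nn_integral_seq_exp_law_component)
  show "(\<integral>\<^sup>+(a, b). ennreal (b i) \<partial>service_law u v) = ennreal (1 / v)"
    unfolding service_law_def using v
    by (subst B.nn_integral_fst[symmetric])
       (auto simp: A.emeasure_space_1 nn_integral_seq_exp_law_component)
qed

lemma nn_integral_service_law_sum1: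
  assumes "u > 0" "v > 0"
  shows "(\<integral>\<^sup>+(a, b). ennreal (\<Sum>i<n. a i) \<partial>service_law u v) = ennreal (real n / u)"
proof -
  have "(\<integral>\<^sup>+(a, b). ennreal (\<Sum>i<n. a i) \<partial>service_law u v) =
      (\<integral>\<^sup>+w. (\<Sum>i<n. ennreal (fst w i)) \<partial>service_law u v)"
    \<comment> \<open>\<open>ennreal\<close> truncates negative values, so the sum splits only where
      the summands are nonnegative, which is almost everywhere.\<close>
    using AE_service_law_nonneg[OF assms]
    by (intro nn_integral_cong_AE) (auto elim!: eventually_mono)
  also have "\<dots> = (\<Sum>i<n. \<integral>\<^sup>+w. ennreal (fst w i) \<partial>service_law u v)"
    by (rule nn_integral_sum) measurable
  also have "\<dots> = ennreal (real n / u)"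
    using nn_integral_service_law_component(1)[OF assms] assms
    by (simp add: case_prod_beta' ennreal_of_nat_eq_real_of_nat flip: ennreal_mult')
  finally show ?thesis .
qed

lemma nn_integral_service_law_sum2:
  assumes "u > 0" "v > 0"
  shows "(\<integral>\<^sup>+(a, b). ennreal (\<Sum>i<n. b i) \<partial>service_law u v) = ennreal (real n / v)"
proof -
  have "(\<integral>\<^sup>+(a, b). ennreal (\<Sum>i<n. b i) \<partial>service_law u v) =
      (\<integral>\<^sup>+w. (\<Sum>i<n. ennreal (snd w i)) \<partial>service_law u v)"
    using AE_service_law_nonneg[OF assms]
    by (intro nn_integral_cong_AE) (auto elim!: eventually_mono)
  also have "\<dots> = (\<Sum>i<n. \<integral>\<^sup>+w. ennreal (snd w i) \<partial>service_law u v)"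
    by (rule nn_integral_sum) measurable
  also have "\<dots> = ennreal (real n / v)"
    using nn_integral_service_law_component(2)[OF assms] assms
    by (simp add: case_prod_beta' ennreal_of_nat_eq_real_of_nat flip: ennreal_mult')
  finally show ?thesis .
qed

section \<open>Expected sojourn times\<close>

text \<open>Induction along the recursion: the pathwise shifts supply the successor states and the
  race supplies their probabilities. Nonnegative integrals avoid separate integrability
  proofs.\<close>

lemma nn_integral_sojourn2:assumes u: "u > 0" and v: "v > 0"
  shows "(\<integral>\<^sup>+(a, b). ennreal (sojourn2 a b n m) \<partial>service_law u v) =
    ennreal (sojourn2_mean u v n m)"
  using assms
proof (induction u v n m rule: sojourn2_mean.induct)
  case (1 u v m)
  have "(\<integral>\<^sup>+(a, b). ennreal (sojourn2 a b 0 m) \<partial>service_law u v) =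
      (\<integral>\<^sup>+(a, b). ennreal (\<Sum>i<m. b i) \<partial>service_law u v)"
    using AE_service_law_nonneg[OF 1]
    by (intro nn_integral_cong_AE)
       (auto elim!: eventually_mono simp: sojourn2_def arrival2_def exit2_already_present)
  then show ?case
    using nn_integral_service_law_sum2[OF 1] by simp
next
  case (2 u v n)
  interpret E: prob_space "exp_law u" by (rule prob_space_exp_law) fact
  have "(\<integral>\<^sup>+(a, b). ennreal (sojourn2 a b (Suc n) 0) \<partial>service_law u v) =
      (\<integral>\<^sup>+x. \<integral>\<^sup>+(a, b). ennreal (sojourn2 (case_nat x a) b (Suc n) 0) \<partial>service_law u v \<partial>exp_law u)"
    by (rule nn_integral_service_law_case_nat1[OF 2(2,3)]) measurable
  also have "\<dots> = (\<integral>\<^sup>+x. \<integral>\<^sup>+(a, b). ennreal (sojourn2 a b n 1) \<partial>service_law u v \<partial>exp_law u)"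
    using AE_exp_law_nonneg[of u]
    by (intro nn_integral_cong_AE) (auto elim!: eventually_mono simp: sojourn2_shift_idle)
  also have "\<dots> = ennreal (sojourn2_mean u v (Suc n) 0)"
    using 2 E.emeasure_space_1 by simp
  finally show ?case .
next
  case (3 u v n m)
  interpret W: prob_space "service_law u v" by (rule prob_space_service_law) fact+
  \<comment> \<open>\<open>f z\<close> and \<open>g z\<close> are the mean times at node 2 after a
    completion at node 1 or node 2 respectively, when the other service has \<open>z\<close>
    left.\<close>
  define f where "f z = (\<integral>\<^sup>+(a, b). ennreal (sojourn2 a (case_nat z b) n (Suc (Suc m))) \<partial>service_law u v)" for z
  define g where "g z = (\<integral>\<^sup>+(a, b). ennreal (sojourn2 (case_nat z a) b (Suc n) m) \<partial>service_law u v)" for z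
  have [measurable]: "f \<in> borel_measurable borel" "g \<in> borel_measurable borel"
    unfolding f_def g_def by measurable
  \<comment> \<open>Averaging over an exponential residual restores the full service law, so the
    induction hypothesis applies.\<close>
  have f: "(\<integral>\<^sup>+z. f z \<partial>exp_law v) = ennreal (sojourn2_mean u v n (Suc (Suc m)))"
    unfolding f_def
    by (subst nn_integral_service_law_case_nat2[symmetric, OF 3(3,4)]) (simp_all add: 3)
  have g: "(\<integral>\<^sup>+z. g z \<partial>exp_law u) = ennreal (sojourn2_mean u v (Suc n) m)"
    unfolding g_def
    by (subst nn_integral_service_law_case_nat1[symmetric, OF 3(3,4)]) (simp_all add: 3)
  have race: "(\<integral>\<^sup>+(a, b). ennreal (sojourn2 (case_nat x a) (case_nat y b) (Suc n) (Suc m)) \<partial>service_law u v) =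
      (if x \<le> y then f (y - x) else g (x - y))" if "0 \<le> x" "0 \<le> y" for x y
    unfolding f_def g_def using that AE_service_law_nonneg[OF 3(3,4)]
    by (auto intro!: nn_integral_cong_AE elim!: eventually_mono
        simp: sojourn2_shift_node1 sojourn2_shift_node2)
  have "(\<integral>\<^sup>+(a, b). ennreal (sojourn2 a b (Suc n) (Suc m)) \<partial>service_law u v) =
      (\<integral>\<^sup>+x. \<integral>\<^sup>+(a, b). ennreal (sojourn2 (case_nat x a) b (Suc n) (Suc m)) \<partial>service_law u v \<partial>exp_law u)"
    by (rule nn_integral_service_law_case_nat1[OF 3(3,4)]) measurable
  also have "\<dots> = (\<integral>\<^sup>+x. \<integral>\<^sup>+y. \<integral>\<^sup>+(a, b). ennreal (sojourn2 (case_nat x a) (case_nat y b) (Suc n) (Suc m))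
      \<partial>service_law u v \<partial>exp_law v \<partial>exp_law u)"
    by (intro nn_integral_cong nn_integral_service_law_case_nat2[OF 3(3,4)]) measurable
  also have "\<dots> = (\<integral>\<^sup>+x. \<integral>\<^sup>+y. (if x \<le> y then f (y - x) else g (x - y)) \<partial>exp_law v \<partial>exp_law u)"
  proof (rule nn_integral_cong_AE)
    show "AE x in exp_law u. (\<integral>\<^sup>+y. \<integral>\<^sup>+(a, b). ennreal (sojourn2 (case_nat x a) (case_nat y b) (Suc n) (Suc m))
        \<partial>service_law u v \<partial>exp_law v) = (\<integral>\<^sup>+y. (if x \<le> y then f (y - x) else g (x - y)) \<partial>exp_law v)"
      using AE_exp_law_nonneg[of u]
    proof eventually_elim
      case (elim x)
      show ?case
        using AE_exp_law_nonneg[of v] by (intro nn_integral_cong_AE, eventually_elim) (rule race[OF elim])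
    qed
  qed
  also have "\<dots> = ennreal (u / (u + v)) * ennreal (sojourn2_mean u v n (Suc (Suc m)))
      + ennreal (v / (u + v)) * ennreal (sojourn2_mean u v (Suc n) m)"
    using exp_law_race[OF 3(3,4), of f g] by (simp add: f g)
  also have "\<dots> = ennreal (sojourn2_mean u v (Suc n) (Suc m))"
    using 3(3,4) by (simp add: sojourn2_mean_nonneg add_divide_distrib flip: ennreal_mult' ennreal_plus)
  finally show ?case .
qed

lemma T1_eq:
  assumes "mu1 > 0" "mu2 > 0"
  shows "T1 mu1 mu2 n m = real n / mu1"
proof -
  have "T1 mu1 mu2 n m = enn2real (\<integral>\<^sup>+w. ennreal (case w of (a, b) \<Rightarrow> exit1 a n) \<partial>service_law mu1 mu2)"
    unfolding T1_def using AE_service_law_nonneg[OF assms]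
    by (intro integral_eq_nn_integral) (auto elim!: eventually_mono simp: exit1_def intro!: sum_nonneg)
  also have "\<dots> = real n / mu1"
    using nn_integral_service_law_sum1[OF assms, of n] assms
    by (simp add: case_prod_beta' exit1_def)
  finally show ?thesis .
qed

lemma T2_eq:
  assumes "mu1 > 0" "mu2 > 0"
  shows "T2 mu1 mu2 n m = sojourn2_mean mu1 mu2 n m"
proof -
  have "T2 mu1 mu2 n m = (\<integral>w. (case w of (a, b) \<Rightarrow> sojourn2 a b n m) \<partial>service_law mu1 mu2)"
    by (simp add: T2_def sojourn2_def)
  also have "\<dots> = enn2real (\<integral>\<^sup>+w. ennreal (case w of (a, b) \<Rightarrow> sojourn2 a b n m) \<partial>service_law mu1 mu2)"
    using AE_service_law_nonneg[OF assms]
    by (intro integral_eq_nn_integral) (auto elim!: eventually_mono simp: sojourn2_nonneg)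
  also have "\<dots> = sojourn2_mean mu1 mu2 n m"
    using nn_integral_sojourn2[OF assms, of n m] sojourn2_mean_nonneg[OF assms]
    by (simp add: case_prod_beta')
  finally show ?thesis .
qed

section \<open>Conditional means given the total, and monotonicity of the profit\<close>

lemma T1_total_eq:
  assumes "mu1 > 0" "mu2 > 0"
  shows "T1_total mu1 mu2 k = (mean_position mu1 mu2 k + 1) / mu1"
proof -
  define W where "W = (\<Sum>n=0..k. mu1 ^ (k - n) * mu2 ^ n)"
  have "T1_total mu1 mu2 k = (\<Sum>n=0..k. mu1 ^ (k - n) * mu2 ^ n * (real n + 1) / W / mu1)"
    unfolding T1_total_def W_def
    by (intro sum.cong refl) (simp add: p1_eq_weight T1_eq assms add.commute)
  also have "\<dots> = (\<Sum>n=0..k. mu1 ^ (k - n) * mu2 ^ n * (real n + 1)) / W / mu1"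
    by (simp add: sum_divide_distrib)
  finally show ?thesis
    unfolding W_def weighted_mean_Suc[OF assms] .
qed

text \<open>The balance equation replaces the mean time at node 2 by
  \<open>(k - n + 1) / mu2\<close>; this is valid for the weighted sum, not in general state by
  state. Reflecting \<open>n\<close> to \<open>k - n\<close> then exchanges the rates.\<close>

lemma T2_total_eq:
  assumes "mu1 > 0" "mu2 > 0"
  shows "T2_total mu1 mu2 k = (mean_position mu2 mu1 k + 1) / mu2"
proof -
  define W where "W = (\<Sum>n=0..k. mu1 ^ (k - n) * mu2 ^ n)"
  have "T2_total mu1 mu2 k =
      (\<Sum>n=0..k. mu1 ^ (k - n) * mu2 ^ n * sojourn2_mean mu1 mu2 (Suc n) (k - n) / W)"
    unfolding T2_total_def W_def
    by (intro sum.cong refl) (simp add: p1_eq_weight T2_eq assms)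
  also have "\<dots> = (\<Sum>n=0..k. mu1 ^ (k - n) * mu2 ^ n * sojourn2_mean mu1 mu2 (Suc n) (k - n)) / W"
    by (simp add: sum_divide_distrib)
  also have "\<dots> = (\<Sum>n=0..k. mu1 ^ (k - n) * mu2 ^ n * (real (k - n) + 1)) / W / mu2"
    unfolding sojourn2_mean_balance[OF assms] by (simp add: sum_divide_distrib mult.commute add.commute)
  finally show ?thesis
    unfolding W_def weighted_mean_reflect[OF assms] .
qed

lemma profit_antimono:
  assumes "mu1 > 0" "mu2 > 0" "C1 \<ge> 0" "C2 \<ge> 0"
  shows "antimono (profit mu1 mu2 R C1 C2)"
proof (rule antimonoI)
  fix k l :: nat
  assume "k \<le> l"
  then have "C1 * T1_total mu1 mu2 k \<le> C1 * T1_total mu1 mu2 l"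
    and "C2 * T2_total mu1 mu2 k \<le> C2 * T2_total mu1 mu2 l"
    using assms mean_position_mono[of mu1 mu2] mean_position_mono[of mu2 mu1]
    by (auto intro!: mult_left_mono divide_right_mono simp: T1_total_eq T2_total_eq incseq_def)
  then show "profit mu1 mu2 R C1 C2 l \<le> profit mu1 mu2 R C1 C2 k"
    by (simp add: profit_def)
qed

theorem theorem11:
  fixes lambda mu1 mu2 R C1 C2 :: real and K :: enat
  assumes "lambda > 0" and "mu1 > 0" and "mu2 > 0"
    and "C1 \<ge> 0" and "C2 \<ge> 0"
    and "R > C1 / mu1 + C2 / mu2"
    and "K = first_negative (profit mu1 mu2 R C1 C2)"
  shows "equilibrium_threshold (profit mu1 mu2 R C1 C2) K
       \<and> dominant_threshold (profit mu1 mu2 R C1 C2) K"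
  using best_response_first_negative[OF profit_antimono \<open>K = _\<close>] assms
  by (simp add: equilibrium_threshold_def dominant_threshold_def)

end
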